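(* Suppose that $p$ is a real number in $[1/2,1]$. Then $\pi_{2,p}(F_5) = \frac{2}{3^{1+p}}$. Moreover, for every $\delta>0$ there exist $\varepsilon>0$ and $N_0>0$ such that the following holds for every integer $n\ge N_0$: every $n$-vertex $F_5$-free $3$-graph $\mathcal{H}$ with $\|\mathcal{H}\|_{2,p} \ge (1-\varepsilon)\cdot \mathrm{ex}_{2,p}(n,F_5)$ is $3$-partite after removing at most $\delta n^3$ edges.
   Context: A $3$-graph $\mathcal{H}$ consists of a finite vertex set $V(\mathcal{H})$ and a collection of $3$-subsets of $V(\mathcal{H})$ (its edges). $F_5$ is the $3$-graph on vertex set $\{1,2,3,4,5\}$ with edges $\{1,2,3\},\{1,2,4\},\{3,4,5\}$. A $3$-graph is $F_5$-free if it contains no copy of $F_5$ as a (not necessarily induced) subgraph. A $3$-graph is $3$-partite if its vertex set can be partitioned into three parts so that every edge contains exactly one vertex from each part. For a set $T\subset V(\mathcal{H})$, $d_{\mathcal{H}}(T)$ is the number of edges of $\mathcal{H}$ containing $T$. For real $p>0$, $\|\mathcal{H}\|_{2,p} := \sum_{T\in\binom{V(\mathcal{H})}{2}} d_{\mathcal{H}}(T)^p$. $\mathrm{ex}_{2,p}(n,F_5)$ is the maximum of $\|\mathcal{H}\|_{2,p}$ over all $n$-vertex $F_5$-free $3$-graphs $\mathcal{H}$, and $\pi_{2,p}(F_5) := \lim_{n\to\infty} \frac{2\cdot\mathrm{ex}_{2,p}(n,F_5)}{n^{2+p}}$ (the limit exists). *)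

theory Defs
  imports "HOL-Analysis.Analysis"
begin

type_synonym 'a hypergraph = "'a set \<times> 'a set set"

abbreviation verts :: "'a hypergraph \<Rightarrow> 'a set" where "verts \<equiv> fst"
abbreviation edges :: "'a hypergraph \<Rightarrow> 'a set set" where "edges \<equiv> snd"

definition three_graph :: "'a hypergraph \<Rightarrow> bool" where
  "three_graph H \<longleftrightarrow> finite (verts H) \<and> (\<forall>e\<in>edges H. e \<subseteq> verts H \<and> card e = 3)"

definition F5 :: "nat hypergraph" where
  "F5 = ({1, 2, 3, 4, 5}, {{1, 2, 3}, {1, 2, 4}, {3, 4, 5}})"

definition contains_copy :: "'b hypergraph \<Rightarrow> 'a hypergraph \<Rightarrow> bool" where
  "contains_copy F H \<longleftrightarrow>
     (\<exists>f. inj_on f (verts F) \<and> f ` verts F \<subseteq> verts H \<and> (\<forall>e\<in>edges F. f ` e \<in> edges H))"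

definition free_of :: "'b hypergraph \<Rightarrow> 'a hypergraph \<Rightarrow> bool" where
  "free_of F H \<longleftrightarrow> \<not> contains_copy F H"

text \<open>Parts may be empty, so that the edgeless 3-graphs on fewer than three vertices
  count as 3-partite.\<close>

definition three_partite :: "'a hypergraph \<Rightarrow> bool" where
  "three_partite H \<longleftrightarrow>
     (\<exists>A B C. A \<union> B \<union> C = verts H \<and> A \<inter> B = {} \<and> A \<inter> C = {} \<and> B \<inter> C = {} \<and>
        (\<forall>e\<in>edges H. card (e \<inter> A) = 1 \<and> card (e \<inter> B) = 1 \<and> card (e \<inter> C) = 1))"

definition degree_of :: "'a hypergraph \<Rightarrow> 'a set \<Rightarrow> nat" where
  "degree_of H T = card {e \<in> edges H. T \<subseteq> e}"

text \<open>Meant for \<open>p > 0\<close>; pairs of degree 0 then contribute 0, since \<open>0 powr p = 0\<close>.\<close>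

definition norm2 :: "real \<Rightarrow> 'a hypergraph \<Rightarrow> real" where
  "norm2 p H = (\<Sum>T | T \<subseteq> verts H \<and> card T = 2. real (degree_of H T) powr p)"

text \<open>Every finite 3-graph is isomorphic to one with vertices in \<^typ>\<open>nat\<close>, so these are
  all the values attained by \<open>n\<close>-vertex \<open>F\<close>-free 3-graphs.\<close>

definition norm2_values :: "real \<Rightarrow> nat \<Rightarrow> 'b hypergraph \<Rightarrow> real set" where
  "norm2_values p n F =
     {norm2 p H | H :: nat hypergraph. three_graph H \<and> card (verts H) = n \<and> free_of F H}"

definition ex2 :: "real \<Rightarrow> nat \<Rightarrow> 'b hypergraph \<Rightarrow> real" where
  "ex2 p n F = Max (norm2_values p n F)"

definition ex2_ratio :: "real \<Rightarrow> 'b hypergraph \<Rightarrow> nat \<Rightarrow> real" where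
  "ex2_ratio p F n = 2 * ex2 p n F / real n powr (2 + p)"

definition pi2 :: "real \<Rightarrow> 'b hypergraph \<Rightarrow> real" where
  "pi2 p F = lim (ex2_ratio p F)"

text \<open>The maximum in \<^const>\<open>ex2\<close> is over a finite set, and a nonempty one if \<open>F\<close> has an edge.\<close>

lemma finite_norm2_values: "finite (norm2_values p n F)"
proof -
  let ?N = "Suc (2 ^ n)"
  let ?\<M> = "{M. set_mset M \<subseteq> {..<?N} \<and> size M = n choose 2}"
  have "norm2_values p n F \<subseteq> (\<lambda>M. \<Sum>d\<in>#M. real d powr p) ` ?\<M>"
  proof
    fix x assume "x \<in> norm2_values p n F"
    then obtain H :: "nat hypergraph"
      where H: "three_graph H" "card (verts H) = n" and x: "x = norm2 p H"
      by (auto simp: norm2_values_def)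
    define P where "P = {T. T \<subseteq> verts H \<and> card T = 2}"
    define M where "M = image_mset (degree_of H) (mset_set P)"
    have fin: "finite (verts H)" and sub: "edges H \<subseteq> Pow (verts H)"
      using H by (auto simp: three_graph_def)
    have finP: "finite P" unfolding P_def using fin by simp
    have "degree_of H T < ?N" for T
    proof -
      have "degree_of H T \<le> card (Pow (verts H))"
        unfolding degree_of_def by (rule card_mono) (use fin sub in auto)
      then show ?thesis using H(2) fin by (simp add: card_Pow)
    qed
    then have "set_mset M \<subseteq> {..<?N}" by (auto simp: M_def)
    moreover have "size M = n choose 2"
      using fin H(2) n_subsets[of "verts H" 2] by (simp add: M_def P_def)
    moreover have "x = (\<Sum>d\<in>#M. real d powr p)"
      using finP by (simp add: x norm2_def M_def P_def sum_unfold_sum_mset image_mset.compositionality o_def)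
    ultimately show "x \<in> (\<lambda>M. \<Sum>d\<in>#M. real d powr p) ` ?\<M>" by blast
  qed
  moreover have "finite ?\<M>"
  proof (rule finite_subset)
    show "?\<M> \<subseteq> mset ` {xs. set xs \<subseteq> {..<?N} \<and> length xs = n choose 2}"
    proof
      fix M assume "M \<in> ?\<M>"
      moreover obtain xs where "M = mset xs" by (metis ex_mset)
      ultimately show "M \<in> mset ` {xs. set xs \<subseteq> {..<?N} \<and> length xs = n choose 2}"
        by auto
    qed
    show "finite (mset ` {xs. set xs \<subseteq> {..<?N} \<and> length xs = n choose 2})"
      by (intro finite_imageI finite_lists_length_eq) simp
  qed
  ultimately show ?thesis by (meson finite_imageI finite_subset)
qed

lemma norm2_values_nonempty:
  assumes "edges F \<noteq> {}"
  shows "norm2_values p n F \<noteq> {}"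
proof -
  have "three_graph ({..<n}, {})" "free_of F ({..<n}, {})"
    using assms by (auto simp: three_graph_def free_of_def contains_copy_def)
  then have "norm2 p ({..<n}, {}) \<in> norm2_values p n F"
    by (auto simp: norm2_values_def intro!: exI[of _ "{..<n}"])
  then show ?thesis by blast
qed

end

(*
In a cancellative 3-graph (no edges abc, abd, cde) every edge xyz satisfies
d(xy) + d(yz) + d(xz) <= n, and |N(x)| <= n - d(yz) for the neighbourhood N(x) of x in the shadow.
Write W for the sum of d(xy)^p over ordered pairs. Sampling a pair with probability d(xy)^p / W and
bounding its entropy gives ln W <= ln n + E[ln |N(X)| + p ln d(XY)]. Expanding the expectation over
edges, the three pairs of an edge carry weights d(T)^(p-1), which are non-increasing in d(T) because p <= 1;
Chebyshev's sum inequality replaces them by equal weights, and the concave function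
c |-> p ln c + ln (n - c), increasing up to n p / (1 + p) >= n / 3 because p >= 1/2, is then averaged.

If all codegree sums are at most (1 - g) n the bound improves by a constant factor. So a nearly
extremal 3-graph has one edge xyz whose codegree sum exceeds (1 - g) n; the sets N(yz), N(xz), N(xy)
are disjoint, contain no two vertices of an edge, and cover all but g n vertices, hence serve as
the three parts.

An F5-free 3-graph becomes cancellative after deleting the O(n^2) edges that contain a pair of
codegree at most 2: if abc and abd are edges, then any edge through cd is cda or cdb.
*)
theory Submission
  imports Defs
begin

section \<open>Analytic inequalities for the three codegrees of an edge\<close>

lemma chebyshev_sum3:
  fixes u v :: "real \<Rightarrow> real"
  assumes "\<And>x y. x \<in> S \<Longrightarrow> y \<in> S \<Longrightarrow> x \<le> y \<Longrightarrow> u y \<le> u x"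
    and "\<And>x y. x \<in> S \<Longrightarrow> y \<in> S \<Longrightarrow> x \<le> y \<Longrightarrow> v x \<le> v y"
    and "a \<in> S" "b \<in> S" "c \<in> S"
  shows "3 * (u a * v a + u b * v b + u c * v c) \<le> (u a + u b + u c) * (v a + v b + v c)"
proof -
  have *: "(u x - u y) * (v x - v y) \<le> 0" if "x \<in> S" "y \<in> S" for x y
    using assms(1,2)[of x y] assms(1,2)[of y x] that
    by (cases "x \<le> y") (auto simp: mult_le_0_iff)
  \<comment> \<open>The gap splits over the three pairs, and each product is at most 0 because
    \<open>u\<close> and \<open>v\<close> are oppositely ordered.\<close>
  have "3 * (u a * v a + u b * v b + u c * v c) - (u a + u b + u c) * (v a + v b + v c)
    = (u a - u b) * (v a - v b) + (u b - u c) * (v b - v c) + (u a - u c) * (v a - v c)"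
    by (simp add: algebra_simps)
  with *[of a b] *[of b c] *[of a c] assms(3-5) show ?thesis by linarith
qed

lemma ln_le_tangent:
  fixes x y :: real
  assumes "0 < x" "0 < y"
  shows "ln x \<le> ln y + (x - y) / y"
proof -
  have "ln (x / y) \<le> x / y - 1" using assms by (intro ln_le_minus_one) auto
  then show ?thesis using assms by (simp add: ln_div diff_divide_distrib)
qed

text \<open>Here \<open>a\<close>, \<open>b\<close>, \<open>c\<close> are the codegrees of the three
  pairs of an edge, and \<open>L\<close> makes every bracket vanish at a = b = c = t n. Since half
  of \<open>g b + g c\<close> is half of the symmetric sum \<open>g a + g b + g c\<close> minus
  \<open>g a / 2\<close>, each bracket is \<open>v\<close> of its own variable plus a common
  constant. Chebyshev's inequality then decouples the weights, leaving the sum of the concave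
  function p ln x + ln (n - x).\<close>

lemma weighted_codegree_inequality:
  fixes n t p a b c :: real
  assumes p: "1 / 2 \<le> p" "p \<le> 1" and t: "0 < t" "t \<le> 1 / 3" and n: "0 < n"
    and pos: "0 < a" "0 < b" "0 < c" and sum: "a + b + c \<le> 3 * t * n"
  defines "L \<equiv> p * ln (t * n) + ln ((1 - t) * n)"
  shows "a powr (p - 1) * (p * ln a + (ln (n - b) + ln (n - c)) / 2 - L) +
    b powr (p - 1) * (p * ln b + (ln (n - a) + ln (n - c)) / 2 - L) +
    c powr (p - 1) * (p * ln c + (ln (n - a) + ln (n - b)) / 2 - L) \<le> 0"
proof -
  define u where "u x = x powr (p - 1)" for x :: real
  define v where "v x = p * ln x - ln (n - x) / 2" for x :: real
  define g where "g x = ln (n - x)" for x :: real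
  \<comment> \<open>As t is at most 1/3, the sum a + b + c is at most n; positivity of the other two
    terms makes each one strictly smaller than n.\<close>
  have "t * n \<le> 1 / 3 * n" using t n by (intro mult_right_mono) auto
  then have lt: "a < n" "b < n" "c < n" using sum pos by linarith+
  have "3 * (u a * v a + u b * v b + u c * v c) \<le> (u a + u b + u c) * (v a + v b + v c)"
  proof (rule chebyshev_sum3[where S = "{0<..<n}"])
    fix x y assume xy: "x \<in> {0<..<n}" "y \<in> {0<..<n}" "x \<le> y"
    show "u y \<le> u x" using xy p by (auto simp: u_def intro!: powr_mono2')
    have "p * ln x \<le> p * ln y" using xy p by (intro mult_left_mono) auto
    moreover have "ln (n - y) \<le> ln (n - x)" using xy by simp
    ultimately show "v x \<le> v y" unfolding v_def by linarith
  qed (use pos lt in auto)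
  moreover have "v a + v b + v c + 3 / 2 * (g a + g b + g c) \<le> 3 * L"
  proof -
    \<comment> \<open>The slope of p ln x + ln (n - x) at x = t n.\<close>
    define s where "s = p / (t * n) - 1 / ((1 - t) * n)"
    \<comment> \<open>This is the condition s >= 0 with denominators cleared. A nonnegative slope is
      what lets an upper bound on a + b + c suffice in place of equality.\<close>
    have "t \<le> p * (1 - t)"
    proof -
      have "1 / 2 * (1 - t) \<le> p * (1 - t)" using p t by (intro mult_right_mono) auto
      then show ?thesis using t by argo
    qed
    then have "n * t \<le> n * (p * (1 - t))" using n by (intro mult_left_mono) auto
    then have s: "s \<ge> 0" using t n by (simp add: s_def field_simps)
    have tan: "p * ln x + g x \<le> L + s * (x - t * n)" if x: "0 < x" "x < n" for x
    proof -
      have "p * ln x \<le> p * (ln (t * n) + (x - t * n) / (t * n))"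
        using p x t n by (intro mult_left_mono ln_le_tangent) auto
      moreover have "g x \<le> ln ((1 - t) * n) + (n - x - (1 - t) * n) / ((1 - t) * n)"
        unfolding g_def using x t n by (intro ln_le_tangent) auto
      moreover have "s * (x - t * n) =
        p * ((x - t * n) / (t * n)) + (n - x - (1 - t) * n) / ((1 - t) * n)"
        using t n by (simp add: s_def divide_simps) (simp add: algebra_simps)
      ultimately show ?thesis by (simp add: L_def algebra_simps)
    qed
    have "s * (a - t * n) + s * (b - t * n) + s * (c - t * n) = s * (a + b + c - 3 * t * n)"
      by (simp add: algebra_simps)
    also have "\<dots> \<le> 0" using s sum by (simp add: mult_le_0_iff)
    finally show ?thesis
      using tan[OF pos(1) lt(1)] tan[OF pos(2) lt(2)] tan[OF pos(3) lt(3)]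
      unfolding v_def g_def by argo
  qed
  then have "(u a + u b + u c) * (v a + v b + v c + 3 / 2 * (g a + g b + g c)) \<le>
      (u a + u b + u c) * (3 * L)"
    by (intro mult_left_mono) (auto simp: u_def)
  moreover have "a powr (p - 1) * (p * ln a + (ln (n - b) + ln (n - c)) / 2 - L) +
      b powr (p - 1) * (p * ln b + (ln (n - a) + ln (n - c)) / 2 - L) +
      c powr (p - 1) * (p * ln c + (ln (n - a) + ln (n - b)) / 2 - L) =
    (u a * v a + u b * v b + u c * v c) +
    (u a + u b + u c) * ((g a + g b + g c) / 2) - (u a + u b + u c) * L"
    unfolding u_def v_def g_def by (simp add: field_simps)
  ultimately show ?thesis by argo
qed

section \<open>Codegrees, neighbourhoods and ordered triples\<close>

definition common_nbrs :: "'a hypergraph \<Rightarrow> 'a \<Rightarrow> 'a \<Rightarrow> 'a set" where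
  "common_nbrs H x y = {z. {x, y, z} \<in> edges H}"

abbreviation codeg :: "'a hypergraph \<Rightarrow> 'a \<Rightarrow> 'a \<Rightarrow> nat" where
  "codeg H x y \<equiv> card (common_nbrs H x y)"

definition nbrs :: "'a hypergraph \<Rightarrow> 'a \<Rightarrow> 'a set" where
  "nbrs H x = {y. \<exists>z. {x, y, z} \<in> edges H}"

text \<open>In a 3-graph each edge appears as six ordered triples, so sums over edges can be
  symmetrized by permuting coordinates.\<close>

definition triples :: "'a hypergraph \<Rightarrow> ('a \<times> 'a \<times> 'a) set" where
  "triples H = {(x, y, z). {x, y, z} \<in> edges H}"

text \<open>As \<open>e\<close> may equal \<open>a\<close> or \<open>b\<close>, this forbids three
  edges on four vertices as well as F5. The case c = d is harmless in a 3-graph, where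
  \<open>{c, d, e}\<close> is then too small to be an edge.\<close>

definition cancellative :: "'a hypergraph \<Rightarrow> bool" where
  "cancellative H \<longleftrightarrow>
     (\<forall>a b c d e. {a, b, c} \<in> edges H \<and> {a, b, d} \<in> edges H \<longrightarrow> {c, d, e} \<notin> edges H)"

lemma edge_distinct:
  assumes "three_graph H" "{x, y, z} \<in> edges H"
  shows "x \<in> verts H" "y \<in> verts H" "z \<in> verts H" "x \<noteq> y" "x \<noteq> z" "y \<noteq> z"
proof -
  have *: "{x, y, z} \<subseteq> verts H" "card {x, y, z} = 3" using assms by (auto simp: three_graph_def)
  then show "x \<in> verts H" "y \<in> verts H" "z \<in> verts H" by auto
  show "x \<noteq> y" "x \<noteq> z" "y \<noteq> z"
    using *(2) by (auto simp: card_insert_if split: if_splits)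
qed

lemma common_nbrs_subset: "three_graph H \<Longrightarrow> common_nbrs H x y \<subseteq> verts H"
  unfolding common_nbrs_def by (blast intro: edge_distinct(3))

lemma finite_common_nbrs: "three_graph H \<Longrightarrow> finite (common_nbrs H x y)"
  by (rule finite_subset[OF common_nbrs_subset]) (simp_all add: three_graph_def)

lemma nbrs_subset: "three_graph H \<Longrightarrow> nbrs H x \<subseteq> verts H"
  unfolding nbrs_def by (blast intro: edge_distinct(2))

lemma common_nbrs_commute: "common_nbrs H x y = common_nbrs H y x"
  by (simp add: common_nbrs_def insert_commute)

lemma common_nbrs_subset_nbrs: "common_nbrs H x y \<subseteq> nbrs H x"
  by (auto simp: common_nbrs_def nbrs_def insert_commute)

lemma triples_subset: "three_graph H \<Longrightarrow> triples H \<subseteq> verts H \<times> verts H \<times> verts H"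
  unfolding triples_def by (auto intro: edge_distinct(1-3))

lemma finite_triples: "three_graph H \<Longrightarrow> finite (triples H)"
  by (rule finite_subset[OF triples_subset]) (auto simp: three_graph_def)

lemma triples_eq_Sigma:
  assumes "three_graph H"
  shows "triples H = (SIGMA x : verts H. SIGMA y : verts H. common_nbrs H x y)"
  unfolding triples_def common_nbrs_def
  using edge_distinct(1,2)[OF assms] by (auto; blast)

lemma sum_triples_swap: "(\<Sum>(x, y, z)\<in>triples H. f y x z) = (\<Sum>(x, y, z)\<in>triples H. f x y z)"
  by (rule sum.reindex_bij_witness[where i = "\<lambda>(x, y, z). (y, x, z)" and j = "\<lambda>(x, y, z). (y, x, z)"])
    (auto simp: triples_def insert_commute)

lemma sum_triples_rotate: "(\<Sum>(x, y, z)\<in>triples H. f y z x) = (\<Sum>(x, y, z)\<in>triples H. f x y z)"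
  by (rule sum.reindex_bij_witness[where i = "\<lambda>(x, y, z). (z, x, y)" and j = "\<lambda>(x, y, z). (y, z, x)"])
    (auto simp: triples_def insert_commute)

lemma degree_of_pair:
  assumes "three_graph H" "x \<noteq> y"
  shows "degree_of H {x, y} = codeg H x y"
proof -
  have "bij_betw (\<lambda>z. {x, y, z}) (common_nbrs H x y) {e \<in> edges H. {x, y} \<subseteq> e}"
  proof (rule bij_betw_imageI)
    show "inj_on (\<lambda>z. {x, y, z}) (common_nbrs H x y)"
    proof (rule inj_onI)
      fix z w
      assume z: "z \<in> common_nbrs H x y" and "w \<in> common_nbrs H x y" and eq: "{x, y, z} = {x, y, w}"
      have "z \<noteq> x" "z \<noteq> y" using edge_distinct[OF assms(1), of x y z] z by (auto simp: common_nbrs_def)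
      moreover have "z \<in> {x, y, w}" unfolding eq[symmetric] by simp
      ultimately show "z = w" by simp
    qed
    show "(\<lambda>z. {x, y, z}) ` common_nbrs H x y = {e \<in> edges H. {x, y} \<subseteq> e}"
    proof (intro equalityI subsetI)
      fix e assume e: "e \<in> {e \<in> edges H. {x, y} \<subseteq> e}"
      then have "card e = 3" using assms by (auto simp: three_graph_def)
      then have "finite e" by (metis card.infinite zero_neq_numeral)
      then have "card (e - {x, y}) = 1" using e assms \<open>card e = 3\<close> by (simp add: card_Diff_subset)
      then obtain z where "e - {x, y} = {z}" by (auto simp: card_1_singleton_iff)
      then have "e = {x, y, z}" using e by blast
      then show "e \<in> (\<lambda>z. {x, y, z}) ` common_nbrs H x y" using e by (auto simp: common_nbrs_def)
    qed (auto simp: common_nbrs_def)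
  qed
  then show ?thesis unfolding degree_of_def by (simp add: bij_betw_same_card)
qed

lemma common_nbrs_diag: "three_graph H \<Longrightarrow> common_nbrs H x x = {}"
  using edge_distinct(4)[of H x x] by (auto simp: common_nbrs_def)

text \<open>Each 2-set comes from two ordered pairs. The diagonal contributes nothing: its codegrees
  are 0, and \<open>0 powr p = 0\<close>.\<close>

lemma double_norm2:
  assumes H: "three_graph H"
  shows "2 * norm2 p H = (\<Sum>x\<in>verts H. \<Sum>y\<in>verts H. real (codeg H x y) powr p)"
proof -
  let ?P = "{T. T \<subseteq> verts H \<and> card T = 2}"
  let ?Q = "{(x, y). x \<in> verts H \<and> y \<in> verts H \<and> x \<noteq> y}"
  have fin: "finite (verts H)" using H by (simp add: three_graph_def)
  have finP: "finite ?P" using fin by simp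
  have finQ: "finite ?Q" by (rule finite_subset[of _ "verts H \<times> verts H"]) (use fin in auto)
  have "(\<Sum>x\<in>verts H. \<Sum>y\<in>verts H. real (codeg H x y) powr p) =
      (\<Sum>(x, y)\<in>verts H \<times> verts H. real (codeg H x y) powr p)"
    by (simp add: sum.cartesian_product)
  also have "\<dots> = (\<Sum>(x, y)\<in>?Q. real (codeg H x y) powr p)"
    by (rule sum.mono_neutral_right) (use fin H in \<open>auto simp: common_nbrs_diag\<close>)
  also have "\<dots> = (\<Sum>T\<in>?P. \<Sum>q | q \<in> ?Q \<and> {fst q, snd q} = T. (case q of (x, y) \<Rightarrow> real (codeg H x y) powr p))"
    by (rule sum.group[symmetric]) (use finQ finP in auto)
  also have "\<dots> = (\<Sum>T\<in>?P. 2 * real (degree_of H T) powr p)"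
  proof (rule sum.cong[OF refl])
    fix T assume "T \<in> ?P"
    then obtain x y where T: "T = {x, y}" "x \<noteq> y" "x \<in> verts H" "y \<in> verts H"
      by (auto simp: card_2_iff)
    then have "{q. q \<in> ?Q \<and> {fst q, snd q} = T} = {(x, y), (y, x)}"
      by (auto simp: doubleton_eq_iff)
    then show "(\<Sum>q | q \<in> ?Q \<and> {fst q, snd q} = T. (case q of (x, y) \<Rightarrow> real (codeg H x y) powr p)) =
        2 * real (degree_of H T) powr p"
      using T degree_of_pair[OF H T(2)] common_nbrs_commute[of H x y] by simp
  qed
  finally show ?thesis by (simp add: norm2_def sum_distrib_left)
qed

section \<open>Disjoint neighbourhoods in cancellative 3-graphs\<close>

lemma cancellative_nbrs:
  assumes H: "three_graph H" "cancellative H" "{x, y, z} \<in> edges H"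
  shows "nbrs H x \<inter> common_nbrs H y z = {}"
proof -
  have False if "{x, w, v} \<in> edges H" "{y, z, w} \<in> edges H" for w v
  proof -
    \<comment> \<open>The edges yzx and yzw share the pair yz, while xwv contains both remaining
      vertices x and w: the forbidden pattern.\<close>
    have "{y, z, x} \<in> edges H" using H(3) by (simp add: insert_commute)
    then show False using H(2) that unfolding cancellative_def by blast
  qed
  then show ?thesis by (auto simp: nbrs_def common_nbrs_def)
qed

text \<open>N(xz) lies inside N(z), and N(z) misses N(xy) because xyz is an edge.\<close>

lemma cancellative_common_nbrs_disjoint:
  assumes H: "three_graph H" "cancellative H" "{x, y, z} \<in> edges H"
  shows "common_nbrs H x y \<inter> common_nbrs H x z = {}"
proof -
  have "{z, x, y} \<in> edges H" using H(3) by (simp add: insert_commute)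
  then have "nbrs H z \<inter> common_nbrs H x y = {}" using H by (intro cancellative_nbrs)
  moreover have "common_nbrs H x z \<subseteq> nbrs H z"
    using common_nbrs_subset_nbrs[of H z x] by (simp add: common_nbrs_commute)
  ultimately show ?thesis by blast
qed

lemma cancellative_codeg_sum:
  assumes H: "three_graph H" "cancellative H" "{x, y, z} \<in> edges H"
  shows "card (common_nbrs H x y \<union> common_nbrs H y z \<union> common_nbrs H x z) =
    codeg H x y + codeg H y z + codeg H x z"
proof -
  have "common_nbrs H x y \<inter> common_nbrs H x z = {}" "common_nbrs H x y \<inter> common_nbrs H y z = {}"
    "common_nbrs H y z \<inter> common_nbrs H x z = {}"
    using cancellative_common_nbrs_disjoint[of H x y z] cancellative_common_nbrs_disjoint[of H y x z]
     cancellative_common_nbrs_disjoint[of H z x y] H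
    by (auto simp: insert_commute common_nbrs_commute)
  then show ?thesis using finite_common_nbrs[OF H(1)]
    by (simp add: card_Un_disjoint Int_Un_distrib2)
qed

lemma cancellative_card_nbrs:
  assumes H: "three_graph H" "cancellative H" "{x, y, z} \<in> edges H"
  shows "real (card (nbrs H x)) \<le> real (card (verts H)) - real (codeg H y z)"
proof -
  have fin: "finite (verts H)" using H by (simp add: three_graph_def)
  have "card (nbrs H x) + codeg H y z = card (nbrs H x \<union> common_nbrs H y z)"
    using finite_subset[OF nbrs_subset[OF H(1)] fin] finite_common_nbrs[OF H(1)]
      cancellative_nbrs[OF H] by (rule card_Un_disjoint[symmetric])
  also have "\<dots> \<le> card (verts H)"
    using fin nbrs_subset[OF H(1)] common_nbrs_subset[OF H(1)] by (intro card_mono) auto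
  finally show ?thesis by linarith
qed

section \<open>The entropy bound\<close>

lemma double_norm2_ln_bound:
  assumes H: "three_graph H" and p: "0 < p" and pos: "0 < norm2 p H"
  shows "2 * norm2 p H * (ln (2 * norm2 p H) - ln (card (verts H))) \<le>
    (\<Sum>x\<in>verts H. \<Sum>y\<in>verts H. real (codeg H x y) powr p *
      (p * ln (codeg H x y) + ln (card (nbrs H x))))"
proof -
  define V where "V = verts H"
  define W where "W = 2 * norm2 p H"
  define n where "n = real (card V)"
  define d where "d x y = real (codeg H x y)" for x y
  define N where "N x = real (card (nbrs H x))" for x
  have W: "W = (\<Sum>x\<in>V. \<Sum>y\<in>V. d x y powr p)"
    by (simp add: W_def V_def d_def double_norm2[OF H])
  have fin: "finite V" using H by (simp add: V_def three_graph_def)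
  have Wpos: "0 < W" using pos by (simp add: W_def)
  then have "V \<noteq> {}" by (auto simp: W)
  then have n: "0 < n" using fin by (simp add: n_def card_gt_0_iff)
  have sub: "nbrs H x \<subseteq> V" for x unfolding V_def by (rule nbrs_subset[OF H])
  have fN: "finite (nbrs H x)" for x using sub fin by (rule finite_subset)
  \<comment> \<open>Nonnegativity of relative entropy, term by term. The law d(x,y)^p / W on ordered
    pairs is compared with the law that picks x uniformly and then y uniformly from N(x), of mass 1
    / (n N(x)); \<open>?q\<close> below is the ratio of the second mass to the first.\<close>
  have "d x y powr p * (ln W - ln n - (p * ln (d x y) + ln (N x))) \<le>
      (if y \<in> nbrs H x then W / (n * N x) else 0) - d x y powr p" for x y
  proof (cases "common_nbrs H x y = {}")
    case True
    then have "d x y = 0" by (simp add: d_def)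
    then show ?thesis using Wpos n p by (simp add: N_def)
  next
    case False
    then have y: "y \<in> nbrs H x" by (auto simp: common_nbrs_def nbrs_def)
    then have Np: "0 < N x" using fN by (auto simp: N_def card_gt_0_iff)
    have dp: "0 < d x y" using False finite_common_nbrs[OF H] by (simp add: d_def card_gt_0_iff)
    let ?q = "W / (n * N x * d x y powr p)"
    have "ln W - ln n - (p * ln (d x y) + ln (N x)) = ln ?q"
      using Wpos n Np dp by (simp add: ln_div ln_mult)
    also have "\<dots> \<le> ?q - 1" using Wpos n Np dp by (intro ln_le_minus_one) simp
    finally have "d x y powr p * (ln W - ln n - (p * ln (d x y) + ln (N x))) \<le> d x y powr p * (?q - 1)"
      by (intro mult_left_mono) auto
    also have "\<dots> = W / (n * N x) - d x y powr p" using n Np dp by (simp add: field_simps)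
    finally show ?thesis using y by simp
  qed
  then have "(\<Sum>x\<in>V. \<Sum>y\<in>V. d x y powr p * (ln W - ln n - (p * ln (d x y) + ln (N x)))) \<le>
      (\<Sum>x\<in>V. \<Sum>y\<in>V. (if y \<in> nbrs H x then W / (n * N x) else 0) - d x y powr p)"
    by (intro sum_mono)
  also have "\<dots> = (\<Sum>x\<in>V. \<Sum>y\<in>V. if y \<in> nbrs H x then W / (n * N x) else 0) - W"
    by (simp add: W sum_subtractf)
  also have "(\<Sum>x\<in>V. \<Sum>y\<in>V. if y \<in> nbrs H x then W / (n * N x) else 0) \<le> (\<Sum>x\<in>V. W / n)"
  proof (rule sum_mono)
    fix x
    have "(\<Sum>y\<in>V. if y \<in> nbrs H x then W / (n * N x) else 0) = N x * (W / (n * N x))"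
      using fin sub[of x] by (simp add: sum.If_cases Int_absorb1 N_def)
    \<comment> \<open>Equality unless x lies in no edge; then N(x) = 0 and the left side is
      0.\<close>
    also have "\<dots> \<le> W / n" using Wpos n by (simp add: N_def)
    finally show "(\<Sum>y\<in>V. if y \<in> nbrs H x then W / (n * N x) else 0) \<le> W / n" .
  qed
  also have "(\<Sum>x\<in>V. W / n) = W" using n by (simp add: n_def)
  finally have "(\<Sum>x\<in>V. \<Sum>y\<in>V. d x y powr p * (ln W - ln n - (p * ln (d x y) + ln (N x)))) \<le> 0"
    by simp
  moreover have "(\<Sum>x\<in>V. \<Sum>y\<in>V. d x y powr p * (ln W - ln n - (p * ln (d x y) + ln (N x)))) =
    W * (ln W - ln n) - (\<Sum>x\<in>V. \<Sum>y\<in>V. d x y powr p * (p * ln (d x y) + ln (N x)))"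
    unfolding right_diff_distrib[of _ "ln W - ln n"] sum_subtractf
    by (simp add: W sum_distrib_right)
  ultimately show ?thesis
    by (simp add: W_def[symmetric] n_def[symmetric] V_def[symmetric] d_def[symmetric] N_def[symmetric])
qed

text \<open>A pair of codegree d extends to exactly d triples, so its weight d^p is spread over them
  as d^(p-1) each. Pairs with d = 0 contribute 0 on both sides.\<close>

lemma sum_pairs_eq_sum_triples:
  assumes H: "three_graph H" and p: "0 < p"
  shows "(\<Sum>x\<in>verts H. \<Sum>y\<in>verts H. real (codeg H x y) powr p * f x y) =
    (\<Sum>(x, y, z)\<in>triples H. real (codeg H x y) powr (p - 1) * f x y)"
proof -
  have fin: "finite (verts H)" using H by (simp add: three_graph_def)
  have "real k * real k powr (p - 1) = real k powr p" for k
    using p by (cases "k = 0") (auto simp: powr_mult_base)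
  then have *: "(\<Sum>z\<in>common_nbrs H x y. real (codeg H x y) powr (p - 1) * f x y) =
      real (codeg H x y) powr p * f x y" for x y
    by (simp add: mult.assoc[symmetric])
  have "(\<Sum>(x, y, z)\<in>triples H. real (codeg H x y) powr (p - 1) * f x y) =
    (\<Sum>x\<in>verts H. \<Sum>y\<in>verts H. \<Sum>z\<in>common_nbrs H x y. real (codeg H x y) powr (p - 1) * f x y)"
    unfolding triples_eq_Sigma[OF H]
    by (simp add: sum.Sigma[symmetric] fin finite_common_nbrs[OF H])
  then show ?thesis unfolding * by simp
qed

text \<open>Averaging over the swap of x and y replaces ln |N(x)| by the mean of ln |N(x)| and ln
  |N(y)|; averaging over rotations collects the three pairs of an edge. Bounding each |N(x)| by n
  minus the codegree of the opposite pair then gives exactly the expression of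
  \<open>weighted_codegree_inequality\<close>.\<close>

lemma cancellative_triple_sum_nonpos:
  fixes t p :: real
  assumes H: "three_graph H" "cancellative H" and p: "1 / 2 \<le> p" "p \<le> 1"
    and t: "0 < t" "t \<le> 1 / 3"
    and sum: "\<And>x y z. {x, y, z} \<in> edges H \<Longrightarrow>
      real (codeg H x y + codeg H y z + codeg H x z) \<le> 3 * t * card (verts H)"
  defines "L \<equiv> p * ln (t * card (verts H)) + ln ((1 - t) * card (verts H))"
  shows "(\<Sum>(x, y, z)\<in>triples H. real (codeg H x y) powr (p - 1) *
    (p * ln (codeg H x y) + ln (card (nbrs H x)) - L)) \<le> 0"
proof -
  define n where "n = real (card (verts H))"
  define d where "d x y = real (codeg H x y)" for x y
  define N where "N x = real (card (nbrs H x))" for x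
  \<comment> \<open>The third argument is a dummy that lets permutations of triples act on
    \<open>F\<close> and \<open>G\<close>.\<close>
  define F where "F x y z = d x y powr (p - 1) * (p * ln (d x y) + ln (N x) - L)" for x y and z :: 'a
  define G where "G x y z = d x y powr (p - 1) * (p * ln (d x y) + (ln (N x) + ln (N y)) / 2 - L)"
    for x y and z :: 'a
  have dcom: "d x y = d y x" for x y by (simp add: d_def common_nbrs_commute)
  have G: "G x y z = (F x y z + F y x z) / 2" for x y z
    by (simp add: F_def G_def dcom[of y x] field_simps)
  have "(\<Sum>(x, y, z)\<in>triples H. G x y z) =
      ((\<Sum>(x, y, z)\<in>triples H. F x y z) + (\<Sum>(x, y, z)\<in>triples H. F y x z)) / 2"
    unfolding G by (simp add: case_prod_unfold sum.distrib sum_divide_distrib add_divide_distrib)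
  then have FG: "(\<Sum>(x, y, z)\<in>triples H. F x y z) = (\<Sum>(x, y, z)\<in>triples H. G x y z)"
    using sum_triples_swap[where f = F] by simp
  have "G x y z + G y z x + G z x y \<le> 0" if e: "{x, y, z} \<in> edges H" for x y z
  proof -
    have e': "{y, z, x} \<in> edges H" "{z, x, y} \<in> edges H" "{y, x, z} \<in> edges H" "{z, y, x} \<in> edges H"
      using e by (simp_all add: insert_commute)
    have mem: "x \<in> common_nbrs H y z" "y \<in> common_nbrs H x z" "z \<in> common_nbrs H x y"
      using e by (simp_all add: common_nbrs_def insert_commute)
    then have pos: "0 < d y z" "0 < d x z" "0 < d x y"
      using finite_common_nbrs[OF H(1)] by (auto simp: d_def card_gt_0_iff)
    have "x \<in> nbrs H y" "y \<in> nbrs H x" "x \<in> nbrs H z"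
      using mem common_nbrs_subset_nbrs common_nbrs_commute by (fast, fast, metis subsetD)
    moreover have "finite (nbrs H w)" for w
      using H(1) nbrs_subset finite_subset unfolding three_graph_def by metis
    ultimately have Npos: "0 < N x" "0 < N y" "0 < N z"
      by (auto simp: N_def card_gt_0_iff)
    have "N x \<le> n - d y z" "N y \<le> n - d x z" "N z \<le> n - d x y"
      using cancellative_card_nbrs[OF H e] cancellative_card_nbrs[OF H e'(3)]
        cancellative_card_nbrs[OF H e'(2)] by (simp_all add: N_def n_def d_def)
    then have ln: "ln (N x) \<le> ln (n - d y z)" "ln (N y) \<le> ln (n - d x z)" "ln (N z) \<le> ln (n - d x y)"
      using Npos by simp_all
    have n: "0 < n" using Npos \<open>N x \<le> n - d y z\<close> pos by linarith
    have "G x y z \<le> d x y powr (p - 1) * (p * ln (d x y) + (ln (n - d y z) + ln (n - d x z)) / 2 - L)"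
      "G y z x \<le> d y z powr (p - 1) * (p * ln (d y z) + (ln (n - d x z) + ln (n - d x y)) / 2 - L)"
      "G z x y \<le> d x z powr (p - 1) * (p * ln (d x z) + (ln (n - d y z) + ln (n - d x y)) / 2 - L)"
      unfolding G_def dcom[of z x] by (intro mult_left_mono; use ln in simp)+
    moreover have "d y z + d x z + d x y \<le> 3 * t * n"
      using sum[OF e] by (simp add: d_def n_def)
    note weighted_codegree_inequality[OF p t n pos this]
    ultimately show ?thesis unfolding L_def n_def[symmetric] by linarith
  qed
  then have "(\<Sum>(x, y, z)\<in>triples H. G x y z + G y z x + G z x y) \<le> 0"
    by (intro sum_nonpos) (auto simp: triples_def)
  moreover have "(\<Sum>(x, y, z)\<in>triples H. G x y z + G y z x + G z x y) =
      3 * (\<Sum>(x, y, z)\<in>triples H. G x y z)"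
    using sum_triples_rotate[where f = G and H = H] sum_triples_rotate[where f = "\<lambda>x y z. G y z x" and H = H]
    by (simp add: case_prod_unfold sum.distrib)
  ultimately have "(\<Sum>(x, y, z)\<in>triples H. F x y z) \<le> 0" using FG by linarith
  then show ?thesis by (simp add: F_def d_def N_def)
qed

text \<open>The entropy bound and the sign of the triple sum give W (ln W - ln n) <= W L; dividing
  by W and exponentiating yields the claim. The value t = 1/3 serves the extremal constant, smaller
  t the stability.\<close>

lemma cancellative_norm2_bound:
  fixes t p :: real
  assumes H: "three_graph H" "cancellative H" and p: "1 / 2 \<le> p" "p \<le> 1"
    and t: "0 < t" "t \<le> 1 / 3"
    and sum: "\<And>x y z. {x, y, z} \<in> edges H \<Longrightarrow>
      real (codeg H x y + codeg H y z + codeg H x z) \<le> 3 * t * card (verts H)"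
  shows "2 * norm2 p H \<le> t powr p * (1 - t) * real (card (verts H)) powr (2 + p)"
proof (cases "0 < norm2 p H")
  case False
  moreover have "0 \<le> t powr p * (1 - t) * real (card (verts H)) powr (2 + p)" using t by simp
  ultimately show ?thesis by linarith
next
  case True
  define W where "W = 2 * norm2 p H"
  define n where "n = real (card (verts H))"
  define L where "L = p * ln (t * n) + ln ((1 - t) * n)"
  have p0: "0 < p" using p by simp
  have "verts H \<noteq> {}" using True double_norm2[OF H(1), of p] by auto
  then have n: "0 < n" using H(1) by (simp add: n_def card_gt_0_iff three_graph_def)
  let ?S = "\<Sum>x\<in>verts H. \<Sum>y\<in>verts H. real (codeg H x y) powr p *
      (p * ln (codeg H x y) + ln (card (nbrs H x)))"
  have "(\<Sum>x\<in>verts H. \<Sum>y\<in>verts H. real (codeg H x y) powr p *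
      (p * ln (codeg H x y) + ln (card (nbrs H x)) - L)) = ?S - W * L"
    unfolding W_def double_norm2[OF H(1)]
    by (simp add: right_diff_distrib[of _ _ L] sum_subtractf sum_distrib_right)
  moreover have "(\<Sum>x\<in>verts H. \<Sum>y\<in>verts H. real (codeg H x y) powr p *
      (p * ln (codeg H x y) + ln (card (nbrs H x)) - L)) \<le> 0"
    unfolding sum_pairs_eq_sum_triples[OF H(1) p0] L_def n_def
    using H p t sum by (rule cancellative_triple_sum_nonpos)
  moreover have "W * (ln W - ln n) \<le> ?S"
    unfolding W_def n_def using H(1) p0 True by (rule double_norm2_ln_bound)
  ultimately have "W * (ln W - ln n) \<le> W * L" by linarith
  then have "ln W \<le> ln n + L" using True by (simp add: W_def)
  also have "\<dots> = ln (n * ((t * n) powr p * ((1 - t) * n)))"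
    using n t by (simp add: L_def ln_mult)
  finally have "W \<le> n * ((t * n) powr p * ((1 - t) * n))"
    using True n t by (simp add: W_def)
  also have "\<dots> = t powr p * (1 - t) * n powr (2 + p)"
    using n t by (simp add: powr_mult powr_add power2_eq_square)
  finally show ?thesis by (simp add: W_def n_def)
qed

section \<open>From F5-free to cancellative by deleting few edges\<close>

definition prune :: "'a hypergraph \<Rightarrow> 'a hypergraph" where
  "prune H = (verts H, {e \<in> edges H. \<forall>x\<in>e. \<forall>y\<in>e. x \<noteq> y \<longrightarrow> 2 < codeg H x y})"

lemma verts_prune [simp]: "verts (prune H) = verts H"
  by (simp add: prune_def)

lemma edges_prune_subset: "edges (prune H) \<subseteq> edges H"
  by (auto simp: prune_def)

lemma three_graph_prune: "three_graph H \<Longrightarrow> three_graph (prune H)"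
  by (auto simp: three_graph_def prune_def)

text \<open>Otherwise 1, ..., 5 could be sent to a, b, c, d, e: the three edges already force all
  the other distinctness conditions.\<close>

lemma F5_free_edges:
  assumes H: "three_graph H" "free_of F5 H"
    and e: "{a, b, c} \<in> edges H" "{a, b, d} \<in> edges H" "{c, d, e} \<in> edges H"
  shows "e = a \<or> e = b"
proof (rule ccontr)
  assume ne: "\<not> (e = a \<or> e = b)"
  define f :: "nat \<Rightarrow> 'a" where
    "f i = (if i = 1 then a else if i = 2 then b else if i = 3 then c else if i = 4 then d else e)" for i
  have f: "f 1 = a" "f (Suc 0) = a" "f 2 = b" "f 3 = c" "f 4 = d" "f 5 = e" by (simp_all add: f_def)
  note dist = edge_distinct[OF H(1) e(1)] edge_distinct[OF H(1) e(2)] edge_distinct[OF H(1) e(3)]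
  have "inj_on f (verts F5)" using dist ne by (auto simp: F5_def f)
  moreover have "f ` verts F5 \<subseteq> verts H" using dist by (auto simp: F5_def f)
  moreover have "\<forall>e\<in>edges F5. f ` e \<in> edges H" using e by (auto simp: F5_def f)
  ultimately have "contains_copy F5 H" unfolding contains_copy_def by blast
  then show False using H(2) by (simp add: free_of_def)
qed

text \<open>The threshold 2 is the size of {a, b}, which contains every common neighbour of c and d.
  \<open>prune\<close> measures codegrees in \<open>H\<close> itself and the contradiction is found
  there, so one round of deletion suffices.\<close>

lemma cancellative_prune:
  assumes H: "three_graph H" "free_of F5 H"
  shows "cancellative (prune H)"
  unfolding cancellative_def
proof (intro allI impI notI)
  fix a b c d e
  assume ab: "{a, b, c} \<in> edges (prune H) \<and> {a, b, d} \<in> edges (prune H)"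
    and cd: "{c, d, e} \<in> edges (prune H)"
  have "c \<noteq> d" using edge_distinct(4)[OF three_graph_prune[OF H(1)] cd] .
  with cd have "2 < codeg H c d" by (auto simp: prune_def)
  moreover have "common_nbrs H c d \<subseteq> {a, b}"
    using F5_free_edges[OF H] ab edges_prune_subset[of H] by (fastforce simp: common_nbrs_def)
  then have "codeg H c d \<le> card {a, b}" by (intro card_mono) auto
  moreover have "card {a, b} \<le> 2" by (simp add: card_insert_if)
  ultimately show False by linarith
qed

lemma card_triples:
  "three_graph H \<Longrightarrow> card (triples H) = (\<Sum>x\<in>verts H. \<Sum>y\<in>verts H. codeg H x y)"
  by (simp add: triples_eq_Sigma finite_common_nbrs three_graph_def)

text \<open>\<open>B\<close> collects the triples whose first two entries have codegree at most 2,
  at most 2 n^2 in number. A lost triple has some pair of low codegree, so it lies in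
  \<open>B\<close> or in one of its two rotations.\<close>

lemma card_triples_prune:
  assumes H: "three_graph H"
  shows "card (triples H - triples (prune H)) \<le> 6 * card (verts H) ^ 2"
proof -
  have fin: "finite (verts H)" using H by (simp add: three_graph_def)
  define B where "B = (SIGMA x : verts H. SIGMA y : verts H. if codeg H x y \<le> 2 then common_nbrs H x y else {})"
  define r where "r = (\<lambda>(x, y, z). (y, z, x) :: 'a \<times> 'a \<times> 'a)"
  have finB: "finite B"
    unfolding B_def by (intro finite_SigmaI) (auto simp: fin finite_common_nbrs[OF H])
  have "card B = (\<Sum>x\<in>verts H. \<Sum>y\<in>verts H. card (if codeg H x y \<le> 2 then common_nbrs H x y else {}))"
    unfolding B_def using fin finite_common_nbrs[OF H] by simp
  also have "\<dots> \<le> (\<Sum>x\<in>verts H. \<Sum>y\<in>verts H. 2)" by (intro sum_mono) auto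
  finally have B: "card B \<le> 2 * card (verts H) ^ 2" by (simp add: power2_eq_square)
  have "triples H - triples (prune H) \<subseteq> B \<union> r ` B \<union> r ` r ` B"
  proof
    fix q assume q: "q \<in> triples H - triples (prune H)"
    obtain x y z where xyz: "q = (x, y, z)" by (cases q)
    with q have e: "{x, y, z} \<in> edges H" and "{x, y, z} \<notin> edges (prune H)"
      by (auto simp: triples_def)
    then consider "codeg H x y \<le> 2" | "codeg H y z \<le> 2" | "codeg H x z \<le> 2"
      using common_nbrs_commute[of H] by (fastforce simp: prune_def)
    then show "q \<in> B \<union> r ` B \<union> r ` r ` B"
    proof cases
      case 1
      then have "(x, y, z) \<in> B"
        using e edge_distinct(1,2)[OF H e] by (auto simp: B_def common_nbrs_def)
      then show ?thesis using xyz by simp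
    next
      case 2
      then have "(y, z, x) \<in> B"
        using e edge_distinct(2,3)[OF H e] by (auto simp: B_def common_nbrs_def insert_commute)
      then have "r (r (y, z, x)) \<in> r ` r ` B" by blast
      then show ?thesis using xyz by (simp add: r_def)
    next
      case 3
      then have "(z, x, y) \<in> B"
        using e edge_distinct(1,3)[OF H e] common_nbrs_commute[of H x z]
        by (auto simp: B_def common_nbrs_def insert_commute)
      then have "r (z, x, y) \<in> r ` B" by blast
      then show ?thesis using xyz by (simp add: r_def)
    qed
  qed
  then have "card (triples H - triples (prune H)) \<le> card (B \<union> r ` B \<union> r ` r ` B)"
    using finB by (intro card_mono) auto
  also have "\<dots> \<le> card B + card (r ` B) + card (r ` r ` B)"
    by (meson add_mono card_Un_le le_refl order_trans)
  also have "card (r ` r ` B) \<le> card (r ` B)" using finB by (intro card_image_le) simp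
  also have "card (r ` B) \<le> card B" using finB by (rule card_image_le)
  finally show ?thesis using B by linarith
qed

lemma card_edges_prune:
  assumes H: "three_graph H"
  shows "card (edges H - edges (prune H)) \<le> 6 * card (verts H) ^ 2"
proof -
  let ?f = "\<lambda>(x, y, z). {x, y, z}"
  have "edges H - edges (prune H) \<subseteq> ?f ` (triples H - triples (prune H))"
  proof
    fix e assume e: "e \<in> edges H - edges (prune H)"
    then have "card e = 3" using H by (auto simp: three_graph_def)
    then obtain x y z where "e = {x, y, z}" by (auto simp: card_3_iff)
    then show "e \<in> ?f ` (triples H - triples (prune H))"
      using e by (auto simp: triples_def intro!: image_eqI[of _ _ "(x, y, z)"])
  qed
  then have "card (edges H - edges (prune H)) \<le> card (triples H - triples (prune H))"
    using finite_triples[OF H] by (intro surj_card_le) auto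
  then show ?thesis using card_triples_prune[OF H] by linarith
qed

text \<open>For l >= 1, (k/l)^p <= k/l gives k^p - l^p <= l^(p-1) (k - l), and l^(p-1) <= 1. For l =
  0 integrality enters, as k^p <= k fails for k strictly between 0 and 1 when p < 1.\<close>

lemma powr_nat_diff_le:
  fixes k l :: nat and p :: real
  assumes "l \<le> k" "0 < p" "p \<le> 1"
  shows "real k powr p \<le> real l powr p + (real k - real l)"
proof (cases "l = 0")
  case True
  have "real k powr p \<le> real k" if "k > 0"
    using powr_mono[of p 1 "real k"] assms that by simp
  then show ?thesis using True by (cases "k = 0") auto
next
  case False
  then have l: "1 \<le> real l" by simp
  have k: "1 \<le> real k / real l" using assms l by simp
  have "real k powr p = real l powr p * (real k / real l) powr p"
    using l by (simp add: powr_mult[symmetric])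
  also have "\<dots> \<le> real l powr p * (real k / real l)"
    using powr_mono[of p 1 "real k / real l"] k assms by (intro mult_left_mono) auto
  also have "\<dots> = real l powr p + real l powr (p - 1) * (real k - real l)"
    using l by (simp add: powr_diff field_simps)
  also have "\<dots> \<le> real l powr p + 1 * (real k - real l)"
    using powr_mono[of "p - 1" 0 "real l"] assms l by (intro add_left_mono mult_right_mono) auto
  finally show ?thesis by simp
qed

text \<open>Each pair loses at most its drop in codegree, and the drops add up to the number of lost
  ordered triples.\<close>

lemma norm2_prune:
  fixes p :: real
  assumes H: "three_graph H" and p: "0 < p" "p \<le> 1"
  shows "2 * norm2 p H \<le> 2 * norm2 p (prune H) + 6 * real (card (verts H)) ^ 2"
proof -
  note H' = three_graph_prune[OF H]
  have le: "codeg (prune H) x y \<le> codeg H x y" for x y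
    using edges_prune_subset[of H] finite_common_nbrs[OF H]
    by (intro card_mono) (auto simp: common_nbrs_def)
  have "2 * norm2 p H \<le> (\<Sum>x\<in>verts H. \<Sum>y\<in>verts H.
      real (codeg (prune H) x y) powr p + (real (codeg H x y) - real (codeg (prune H) x y)))"
    unfolding double_norm2[OF H] using le p by (intro sum_mono powr_nat_diff_le) auto
  also have "\<dots> = 2 * norm2 p (prune H) + (real (card (triples H)) - real (card (triples (prune H))))"
    unfolding double_norm2[OF H'] card_triples[OF H] card_triples[OF H']
    by (simp add: sum.distrib sum_subtractf)
  also have "triples (prune H) \<subseteq> triples H"
    using edges_prune_subset[of H] by (auto simp: triples_def)
  then have "real (card (triples H)) - real (card (triples (prune H))) = card (triples H - triples (prune H))"
    using finite_triples[OF H] finite_triples[OF H']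
    by (simp add: card_Diff_subset card_mono)
  also have "\<dots> \<le> 6 * real (card (verts H)) ^ 2"
    using card_triples_prune[OF H] by (simp flip: of_nat_le_iff[where 'a = real])
  finally show ?thesis by simp
qed

section \<open>Lower bound: the complete 3-partite 3-graph on the residue classes mod 3\<close>

definition tripartite_graph :: "nat \<Rightarrow> nat hypergraph" where
  "tripartite_graph n = ({..<n}, {e. e \<subseteq> {..<n} \<and> card e = 3 \<and> inj_on (\<lambda>v. v mod 3) e})"

lemma verts_tripartite_graph: "verts (tripartite_graph n) = {..<n}"
  by (simp add: tripartite_graph_def)

lemma three_graph_tripartite_graph: "three_graph (tripartite_graph n)"
  by (simp add: three_graph_def tripartite_graph_def)

lemma F5_free_tripartite_graph: "free_of F5 (tripartite_graph n)"
  unfolding free_of_def contains_copy_def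
proof (intro notI, elim exE conjE)
  fix f assume "inj_on f (verts F5)" and "\<forall>e\<in>edges F5. f ` e \<in> edges (tripartite_graph n)"
  then have ne: "f 1 \<noteq> f 2" "f 1 \<noteq> f 3" "f 2 \<noteq> f 3" "f 1 \<noteq> f 4" "f 2 \<noteq> f 4" "f 3 \<noteq> f 4"
    and inj: "inj_on (\<lambda>v. v mod 3) {f 1, f 2, f 3}" "inj_on (\<lambda>v. v mod 3) {f 1, f 2, f 4}"
      "inj_on (\<lambda>v. v mod 3) {f 3, f 4, f 5}"
    by (simp_all add: F5_def tripartite_graph_def inj_on_eq_iff)
  \<comment> \<open>Every two of the four vertices 1, 2, 3, 4 of F5 lie in a common edge, so four
    different residues mod 3 would be needed.\<close>
  have "f 1 mod 3 \<noteq> f 2 mod 3" "f 1 mod 3 \<noteq> f 3 mod 3" "f 2 mod 3 \<noteq> f 3 mod 3"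
    "f 1 mod 3 \<noteq> f 4 mod 3" "f 2 mod 3 \<noteq> f 4 mod 3" "f 3 mod 3 \<noteq> f 4 mod 3"
    using inj ne by (auto simp: inj_on_def)
  moreover have "f i mod 3 < 3" for i by simp
  note this[of 1] this[of 2] this[of 3] this[of 4]
  ultimately show False by linarith
qed

lemma codeg_tripartite_graph:
  assumes xy: "x < n" "y < n" "x mod 3 \<noteq> y mod 3"
  shows "n div 3 \<le> codeg (tripartite_graph n) x y"
proof -
  obtain r where r: "r < 3" "r \<noteq> x mod 3" "r \<noteq> y mod 3"
    using xy(3) that[of 0] that[of 1] that[of 2] by linarith
  have "(\<lambda>i. 3 * i + r) ` {..<n div 3} \<subseteq> common_nbrs (tripartite_graph n) x y"
  proof
    fix z assume "z \<in> (\<lambda>i. 3 * i + r) ` {..<n div 3}"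
    then have z: "z < n" "z mod 3 = r" using r(1) by auto
    then have "x \<noteq> z" "y \<noteq> z" "x \<noteq> y" using r xy by auto
    moreover have "inj_on (\<lambda>v. v mod 3) {x, y, z}" using r xy z by (auto simp: inj_on_def)
    ultimately show "z \<in> common_nbrs (tripartite_graph n) x y"
      using xy z by (simp add: common_nbrs_def tripartite_graph_def)
  qed
  then have "card ((\<lambda>i. 3 * i + r) ` {..<n div 3}) \<le> codeg (tripartite_graph n) x y"
    by (intro card_mono finite_common_nbrs three_graph_tripartite_graph)
  then show ?thesis by (simp add: card_image inj_on_def)
qed

text \<open>There are six ordered pairs of distinct residues, and each residue class has at least
  \<open>n div 3\<close> members below \<open>n\<close>.\<close>

lemma card_pairs_distinct_mod3:
  "6 * (n div 3) ^ 2 \<le> card {(x, y). x < n \<and> y < n \<and> x mod 3 \<noteq> y mod 3}"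
proof -
  let ?Q = "{(x, y). x < n \<and> y < n \<and> x mod 3 \<noteq> y mod 3}"
  let ?R = "{(0, 1), (0, 2), (1, 0), (1, 2), (2, 0), (2, 1)} :: (nat \<times> nat) set"
  let ?f = "\<lambda>((r, s), (i, j)). (3 * i + r, 3 * j + s)"
  have fin: "finite ?Q" by (rule finite_subset[of _ "{..<n} \<times> {..<n}"]) auto
  have "inj_on ?f (?R \<times> ({..<n div 3} \<times> {..<n div 3}))"
    unfolding inj_on_def by (auto; presburger)
  moreover have "?f ` (?R \<times> ({..<n div 3} \<times> {..<n div 3})) \<subseteq> ?Q" by (auto; presburger)
  ultimately have "card (?R \<times> ({..<n div 3} \<times> {..<n div 3})) \<le> card ?Q"
    using fin by (rule card_inj_on_le)
  then show ?thesis by (simp add: card_cartesian_product power2_eq_square)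
qed

lemma norm2_tripartite_graph:
  assumes p: "0 < p"
  shows "6 * real (n div 3) powr (2 + p) \<le> 2 * norm2 p (tripartite_graph n)"
proof -
  let ?Q = "{(x, y). x < n \<and> y < n \<and> x mod 3 \<noteq> y mod 3}"
  let ?m = "n div 3"
  have "6 * real ?m powr (2 + p) = real (6 * ?m ^ 2) * real ?m powr p"
    by (simp add: powr_add)
  also have "\<dots> \<le> real (card ?Q) * real ?m powr p"
    using card_pairs_distinct_mod3[of n] by (intro mult_right_mono of_nat_mono) auto
  also have "\<dots> = (\<Sum>(x, y)\<in>?Q. real ?m powr p)" by simp
  also have "\<dots> \<le> (\<Sum>(x, y)\<in>?Q. real (codeg (tripartite_graph n) x y) powr p)"
    using p codeg_tripartite_graph by (intro sum_mono) (auto intro!: powr_mono2)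
  also have "\<dots> \<le> (\<Sum>(x, y)\<in>{..<n} \<times> {..<n}. real (codeg (tripartite_graph n) x y) powr p)"
    by (intro sum_mono2) auto
  also have "\<dots> = 2 * norm2 p (tripartite_graph n)"
    unfolding double_norm2[OF three_graph_tripartite_graph] verts_tripartite_graph
    by (simp add: sum.cartesian_product)
  finally show ?thesis .
qed

section \<open>The extremal number and its limit\<close>

lemma cancellative_codeg_sum_le:
  assumes H: "three_graph H" "cancellative H" "{x, y, z} \<in> edges H"
  shows "codeg H x y + codeg H y z + codeg H x z \<le> card (verts H)"
  unfolding cancellative_codeg_sum[OF H, symmetric]
  using H(1) common_nbrs_subset[OF H(1)] by (intro card_mono) (auto simp: three_graph_def)

lemma F5_free_norm2_bound:
  fixes p :: real
  assumes H: "three_graph H" "free_of F5 H" and p: "1 / 2 \<le> p" "p \<le> 1"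
  shows "2 * norm2 p H \<le>
    2 / 3 powr (1 + p) * real (card (verts H)) powr (2 + p) + 6 * real (card (verts H)) ^ 2"
proof -
  note H' = three_graph_prune[OF H(1)] cancellative_prune[OF H]
  \<comment> \<open>At t = 1/3 the condition on codegree sums is just the bound by n that
    disjointness provides.\<close>
  have "2 * norm2 p (prune H) \<le> (1 / 3) powr p * (1 - 1 / 3) * real (card (verts (prune H))) powr (2 + p)"
  proof (rule cancellative_norm2_bound[OF H' p])
    fix x y z assume "{x, y, z} \<in> edges (prune H)"
    from cancellative_codeg_sum_le[OF H' this]
    show "real (codeg (prune H) x y + codeg (prune H) y z + codeg (prune H) x z) \<le>
        3 * (1 / 3) * real (card (verts (prune H)))" by (simp del: of_nat_add)
  qed auto
  also have "(1 / 3) powr p * (1 - 1 / 3) = 2 / 3 powr (1 + p)"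
    by (simp add: powr_divide powr_add)
  finally show ?thesis using norm2_prune[OF H(1), of p] p by simp
qed

lemma ex2_F5_le:
  fixes p :: real
  assumes p: "1 / 2 \<le> p" "p \<le> 1"
  shows "2 * ex2 p n F5 \<le> 2 / 3 powr (1 + p) * real n powr (2 + p) + 6 * real n ^ 2"
proof -
  have "norm2_values p n F5 \<noteq> {}" by (rule norm2_values_nonempty) (simp add: F5_def)
  then have "ex2 p n F5 \<in> norm2_values p n F5"
    unfolding ex2_def using finite_norm2_values by (intro Max_in)
  then show ?thesis using F5_free_norm2_bound p by (auto simp: norm2_values_def)
qed

lemma ex2_F5_ge:
  assumes "0 < p"
  shows "6 * real (n div 3) powr (2 + p) \<le> 2 * ex2 p n F5"
proof -
  have "norm2 p (tripartite_graph n) \<in> norm2_values p n F5"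
    unfolding norm2_values_def
    using three_graph_tripartite_graph[of n] F5_free_tripartite_graph[of n]
    by (intro CollectI exI[of _ "tripartite_graph n"]) (simp add: verts_tripartite_graph)
  then have "norm2 p (tripartite_graph n) \<le> ex2 p n F5"
    unfolding ex2_def by (intro Max_ge finite_norm2_values)
  then show ?thesis using norm2_tripartite_graph[OF assms, of n] by linarith
qed

lemma ex2_ratio_F5_tendsto:
  fixes p :: real
  assumes p: "1 / 2 \<le> p" "p \<le> 1"
  shows "ex2_ratio p F5 \<longlonglongrightarrow> 2 / 3 powr (1 + p)"
proof (rule tendsto_sandwich)
  have inv: "(\<lambda>n. 1 / real n) \<longlonglongrightarrow> 0" by (rule lim_1_over_n)
  have "(\<lambda>n. 6 * (1 / 3 - 1 / real n) powr (2 + p)) \<longlonglongrightarrow> 6 * (1 / 3 - 0) powr (2 + p)"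
    by (intro tendsto_intros inv) auto
  then show "(\<lambda>n. 6 * (1 / 3 - 1 / real n) powr (2 + p)) \<longlonglongrightarrow> 2 / 3 powr (1 + p)"
    by (simp add: powr_divide powr_add)
  have "(\<lambda>n. 2 / 3 powr (1 + p) + 6 * real n powr (- p)) \<longlonglongrightarrow> 2 / 3 powr (1 + p) + 6 * 0"
    using p by (intro tendsto_intros tendsto_neg_powr filterlim_real_sequentially) auto
  then show "(\<lambda>n. 2 / 3 powr (1 + p) + 6 * real n powr (- p)) \<longlonglongrightarrow> 2 / 3 powr (1 + p)" by simp
  show "\<forall>\<^sub>F n in sequentially. 6 * (1 / 3 - 1 / real n) powr (2 + p) \<le> ex2_ratio p F5 n"
  proof (rule eventually_sequentiallyI)
    \<comment> \<open>This keeps the base n/3 - 1 nonnegative, as monotonicity of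
      \<open>powr\<close> requires.\<close>
    fix n :: nat assume n: "3 \<le> n"
    have "real n / 3 - 1 \<le> real (n div 3)" by linarith
    then have "6 * (real n / 3 - 1) powr (2 + p) \<le> 6 * real (n div 3) powr (2 + p)"
      using n p by (intro mult_left_mono powr_mono2) auto
    also have "\<dots> \<le> 2 * ex2 p n F5" using p by (intro ex2_F5_ge) auto
    finally have "6 * (real n / 3 - 1) powr (2 + p) / real n powr (2 + p) \<le> ex2_ratio p F5 n"
      unfolding ex2_ratio_def by (intro divide_right_mono) auto
    also have "6 * (real n / 3 - 1) powr (2 + p) / real n powr (2 + p) =
        6 * ((real n / 3 - 1) / real n) powr (2 + p)"
      using n by (simp add: powr_divide)
    also have "(real n / 3 - 1) / real n = 1 / 3 - 1 / real n" using n by (simp add: field_simps)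
    finally show "6 * (1 / 3 - 1 / real n) powr (2 + p) \<le> ex2_ratio p F5 n" .
  qed
  show "\<forall>\<^sub>F n in sequentially. ex2_ratio p F5 n \<le> 2 / 3 powr (1 + p) + 6 * real n powr (- p)"
  proof (rule eventually_sequentiallyI)
    fix n :: nat assume n: "1 \<le> n"
    have "ex2_ratio p F5 n \<le>
        (2 / 3 powr (1 + p) * real n powr (2 + p) + 6 * real n ^ 2) / real n powr (2 + p)"
      unfolding ex2_ratio_def using ex2_F5_le[OF p] by (intro divide_right_mono) auto
    also have "\<dots> = 2 / 3 powr (1 + p) + 6 * real n powr (- p)"
      using n by (simp add: add_divide_distrib powr_add powr_minus_divide)
    finally show "ex2_ratio p F5 n \<le> 2 / 3 powr (1 + p) + 6 * real n powr (- p)" .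
  qed
qed

section \<open>Stability\<close>

lemma powr_mult_one_minus_less:
  fixes p t :: real
  assumes p: "1 / 2 \<le> p" and t: "0 < t" "t < 1 / 3"
  shows "t powr p * (1 - t) < 2 / 3 powr (1 + p)"
proof -
  \<comment> \<open>After division by the value at t = 1/3 the claim reads (3t)^p (3/2)(1 - t) < 1.
    Both logarithms are bounded by ln x <= x - 1; the linear parts cancel when p = 1/2 and larger p
    only helps since 3t < 1. Strictness comes from 3t being different from 1.\<close>
  have "ln (3 * t) < 3 * t - 1"
    using ln_le_minus_one[of "3 * t"] ln_eq_minus_one[of "3 * t"] t by fastforce
  then have "p * ln (3 * t) < p * (3 * t - 1)" using p by (intro mult_strict_left_mono) auto
  also have "\<dots> \<le> 1 / 2 * (3 * t - 1)" using p t by (intro mult_right_mono_neg) auto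
  also have "ln (3 / 2 * (1 - t)) \<le> 3 / 2 * (1 - t) - 1" using t by (intro ln_le_minus_one) auto
  then have "1 / 2 * (3 * t - 1) \<le> - ln (3 / 2 * (1 - t))" by (simp add: field_simps)
  finally have "p * ln (3 * t) + ln (3 / 2 * (1 - t)) < 0" by linarith
  then have "ln ((3 * t) powr p * (3 / 2 * (1 - t))) < ln 1"
    using t by (subst ln_mult) auto
  then have "(3 * t) powr p * (3 / 2 * (1 - t)) < 1" using t by (subst (asm) ln_less_cancel_iff) auto
  then show ?thesis using t by (simp add: powr_mult powr_add field_simps)
qed

text \<open>Two vertices u, v of an edge uvw that both lie in N(xy) would give edges xyu, xyv, uvw,
  the forbidden pattern.\<close>

lemma common_nbrs_independent:
  assumes H: "three_graph H" "cancellative H" and e: "e \<in> edges H"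
  shows "card (e \<inter> common_nbrs H x y) \<le> 1"
proof -
  have e3: "card e = 3" using H e by (auto simp: three_graph_def)
  then have fin: "finite e" by (metis card.infinite zero_neq_numeral)
  have "u = v" if uv: "u \<in> e" "v \<in> e" "{x, y, u} \<in> edges H" "{x, y, v} \<in> edges H" for u v
  proof (rule ccontr)
    assume "u \<noteq> v"
    then have "card (e - {u, v}) = 1" using uv fin e3 by (simp add: card_Diff_subset)
    then obtain w where "e - {u, v} = {w}" by (auto simp: card_1_singleton_iff)
    then have "e = {u, v, w}" using uv by blast
    then show False using H(2) uv e unfolding cancellative_def by blast
  qed
  then have "\<forall>u\<in>e \<inter> common_nbrs H x y. \<forall>v\<in>e \<inter> common_nbrs H x y. u = v"
    by (auto simp: common_nbrs_def)
  then show ?thesis using fin by (simp add: card_le_Suc0_iff_eq)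
qed

lemma card_edges_meeting_le:
  assumes H: "three_graph H" and Z: "Z \<subseteq> verts H"
  shows "card {e \<in> edges H. e \<inter> Z \<noteq> {}} \<le> card Z * card (verts H) ^ 2"
proof -
  let ?f = "\<lambda>(u, v, w). {u, v, w}"
  have fin: "finite (verts H)" using H by (simp add: three_graph_def)
  then have "finite Z" using Z finite_subset by blast
  have "{e \<in> edges H. e \<inter> Z \<noteq> {}} \<subseteq> ?f ` (Z \<times> verts H \<times> verts H)"
  proof
    fix e assume "e \<in> {e \<in> edges H. e \<inter> Z \<noteq> {}}"
    then obtain u where e: "e \<subseteq> verts H" "card e = 3" and u: "u \<in> e" "u \<in> Z"
      using H by (auto simp: three_graph_def)
    then have "card (e - {u}) = 2" by simp
    then obtain v w where "e - {u} = {v, w}" by (auto simp: card_2_iff)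
    then have "e = {u, v, w}" using u by blast
    then show "e \<in> ?f ` (Z \<times> verts H \<times> verts H)"
      using e u by (auto intro!: image_eqI[of _ _ "(u, v, w)"])
  qed
  then have "card {e \<in> edges H. e \<inter> Z \<noteq> {}} \<le> card (Z \<times> verts H \<times> verts H)"
    using fin \<open>finite Z\<close> by (intro surj_card_le) auto
  then show ?thesis by (simp add: card_cartesian_product power2_eq_square)
qed

lemma cancellative_near_tripartite:
  fixes \<gamma> :: real
  assumes H: "three_graph H" "cancellative H" and e: "{x, y, z} \<in> edges H"
    and large: "(1 - \<gamma>) * card (verts H) \<le> real (codeg H x y + codeg H y z + codeg H x z)"
  shows "\<exists>R \<subseteq> edges H. real (card R) \<le> \<gamma> * real (card (verts H)) ^ 3 \<and>
    three_partite (verts H, edges H - R)"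
proof -
  define A B C where "A = common_nbrs H y z" and "B = common_nbrs H x z" and "C = common_nbrs H x y"
  define Z where "Z = verts H - (A \<union> B \<union> C)"
  define R where "R = {e \<in> edges H. e \<inter> Z \<noteq> {}}"
  have fin: "finite (verts H)" using H by (simp add: three_graph_def)
  have sub: "A \<subseteq> verts H" "B \<subseteq> verts H" "C \<subseteq> verts H"
    using common_nbrs_subset[OF H(1)] by (simp_all add: A_def B_def C_def)
  have e': "{y, x, z} \<in> edges H" "{z, x, y} \<in> edges H" using e by (simp_all add: insert_commute)
  have disj: "A \<inter> B = {}" "A \<inter> C = {}" "B \<inter> C = {}"
    using cancellative_common_nbrs_disjoint[OF H e] cancellative_common_nbrs_disjoint[OF H e'(1)]
      cancellative_common_nbrs_disjoint[OF H e'(2)]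
    by (auto simp: A_def B_def C_def common_nbrs_commute[of H z] common_nbrs_commute[of H y x])
  have "card (A \<union> B \<union> C) = codeg H x y + codeg H y z + codeg H x z"
    using cancellative_codeg_sum[OF H e] by (simp add: A_def B_def C_def Un_ac)
  moreover have "card Z + card (A \<union> B \<union> C) = card (verts H)"
    unfolding Z_def using sub fin by (metis card_Diff_subset card_mono finite_subset le_add_diff_inverse2 Un_least)
  ultimately have "real (card Z) \<le> \<gamma> * card (verts H)" using large by (simp add: algebra_simps)
  then have "real (card Z) * real (card (verts H)) ^ 2 \<le> \<gamma> * card (verts H) * real (card (verts H)) ^ 2"
    by (intro mult_right_mono) auto
  moreover have "real (card R) \<le> real (card Z) * real (card (verts H)) ^ 2"
  proof -
    have "Z \<subseteq> verts H" by (simp add: Z_def)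
    from of_nat_mono[OF card_edges_meeting_le[OF H(1) this], where 'a = real]
    show ?thesis by (simp add: R_def)
  qed
  ultimately have "real (card R) \<le> \<gamma> * real (card (verts H)) ^ 3"
    by (simp add: power2_eq_square power3_eq_cube)
  moreover have "three_partite (verts H, edges H - R)"
    unfolding three_partite_def
  proof (intro exI conjI ballI)
    \<comment> \<open>The uncovered vertices \<open>Z\<close> may join any part, because every edge
      meeting them is in \<open>R\<close>.\<close>
    show "(A \<union> Z) \<union> B \<union> C = verts (verts H, edges H - R)" using sub by (auto simp: Z_def)
    show "(A \<union> Z) \<inter> B = {}" "(A \<union> Z) \<inter> C = {}" "B \<inter> C = {}" using disj by (auto simp: Z_def)
    fix f assume "f \<in> edges (verts H, edges H - R)"
    then have f: "f \<in> edges H" "f \<inter> Z = {}" by (auto simp: R_def)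
    then have f3: "f \<subseteq> A \<union> B \<union> C" "card f = 3"
      using H by (auto simp: three_graph_def Z_def)
    then have "f = (f \<inter> A) \<union> (f \<inter> B) \<union> (f \<inter> C)" by blast
    \<comment> \<open>Three vertices spread over three sets, with at most one in each, means exactly
      one in each.\<close>
    then have "3 \<le> card (f \<inter> A) + card (f \<inter> B) + card (f \<inter> C)"
      using f3(2) card_Un_le[of "(f \<inter> A) \<union> (f \<inter> B)" "f \<inter> C"] card_Un_le[of "f \<inter> A" "f \<inter> B"] by simp
    moreover have "card (f \<inter> A) \<le> 1" "card (f \<inter> B) \<le> 1" "card (f \<inter> C) \<le> 1"
      unfolding A_def B_def C_def using common_nbrs_independent[OF H f(1)] by blast+
    moreover have "f \<inter> (A \<union> Z) = f \<inter> A" using f(2) by blast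
    ultimately show "card (f \<inter> (A \<union> Z)) = 1" "card (f \<inter> B) = 1" "card (f \<inter> C) = 1" by simp_all
  qed
  ultimately show ?thesis by (intro exI[of _ R]) (auto simp: R_def)
qed

text \<open>The hypothesis exceeds the bound for t = (1 - \<gamma>) / 3 by more than the loss in
  pruning, so the pruned 3-graph must contain an edge with codegree sum at least (1 - \<gamma>) n.
  The removed set consists of the pruned edges and those missing the resulting partition.\<close>

lemma F5_free_stability:
  fixes p \<gamma> :: real
  assumes H: "three_graph H" "free_of F5 H" and p: "1 / 2 \<le> p" "p \<le> 1"
    and \<gamma>: "0 < \<gamma>" "\<gamma> < 1"
    and large: "((1 - \<gamma>) / 3) powr p * (1 - (1 - \<gamma>) / 3) * real (card (verts H)) powr (2 + p) +
      6 * real (card (verts H)) ^ 2 < 2 * norm2 p H"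
  shows "\<exists>R \<subseteq> edges H. real (card R) \<le> \<gamma> * real (card (verts H)) ^ 3 + 6 * real (card (verts H)) ^ 2 \<and>
    three_partite (verts H, edges H - R)"
proof -
  note H' = three_graph_prune[OF H(1)] cancellative_prune[OF H]
  have "\<exists>x y z. {x, y, z} \<in> edges (prune H) \<and> (1 - \<gamma>) * card (verts (prune H)) \<le>
      real (codeg (prune H) x y + codeg (prune H) y z + codeg (prune H) x z)"
  proof (rule ccontr)
    assume none: "\<not> ?thesis"
    have "real (codeg (prune H) x y + codeg (prune H) y z + codeg (prune H) x z) \<le>
        3 * ((1 - \<gamma>) / 3) * card (verts (prune H))" if "{x, y, z} \<in> edges (prune H)" for x y z
    proof -
      have "\<not> (1 - \<gamma>) * card (verts (prune H)) \<le>
          real (codeg (prune H) x y + codeg (prune H) y z + codeg (prune H) x z)"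
        using none that by blast
      moreover have "3 * ((1 - \<gamma>) / 3) = 1 - \<gamma>" by simp
      ultimately show ?thesis by linarith
    qed
    then have "2 * norm2 p (prune H) \<le>
        ((1 - \<gamma>) / 3) powr p * (1 - (1 - \<gamma>) / 3) * real (card (verts (prune H))) powr (2 + p)"
      using \<gamma> by (intro cancellative_norm2_bound H' p) auto
    then show False using norm2_prune[OF H(1), of p] p large by simp
  qed
  then obtain x y z where e: "{x, y, z} \<in> edges (prune H)" and
    xyz: "(1 - \<gamma>) * card (verts (prune H)) \<le>
      real (codeg (prune H) x y + codeg (prune H) y z + codeg (prune H) x z)" by blast
  obtain R where R: "R \<subseteq> edges (prune H)" "real (card R) \<le> \<gamma> * real (card (verts H)) ^ 3"
    "three_partite (verts H, edges (prune H) - R)"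
    using cancellative_near_tripartite[OF H' e xyz] by auto
  let ?R = "(edges H - edges (prune H)) \<union> R"
  have "edges H - ?R = edges (prune H) - R" using edges_prune_subset[of H] by blast
  moreover have "real (card ?R) \<le> \<gamma> * real (card (verts H)) ^ 3 + 6 * real (card (verts H)) ^ 2"
  proof -
    have "card ?R \<le> card (edges H - edges (prune H)) + card R" by (rule card_Un_le)
    also have "\<dots> \<le> 6 * card (verts H) ^ 2 + card R" using card_edges_prune[OF H(1)] by simp
    finally have "real (card ?R) \<le> 6 * real (card (verts H)) ^ 2 + real (card R)"
      by (simp flip: of_nat_le_iff[where 'a = real])
    then show ?thesis using R(2) by linarith
  qed
  ultimately show ?thesis using R edges_prune_subset[of H] by (intro exI[of _ ?R]) auto
qed

theorem theorem1p2:
  fixes p :: real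
  assumes "1 / 2 \<le> p" "p \<le> 1"
  shows "convergent (ex2_ratio p F5) \<and> pi2 p F5 = 2 / 3 powr (1 + p) \<and>
    (\<forall>\<delta>::real. \<delta> > 0 \<longrightarrow>
      (\<exists>(\<epsilon>::real) (N\<^sub>0::nat). \<epsilon> > 0 \<and> N\<^sub>0 > 0 \<and>
        (\<forall>n::nat. n \<ge> N\<^sub>0 \<longrightarrow>
          (\<forall>H :: 'a hypergraph.
             three_graph H \<and> card (verts H) = n \<and> free_of F5 H \<and>
             norm2 p H \<ge> (1 - \<epsilon>) * ex2 p n F5 \<longrightarrow>
             (\<exists>R \<subseteq> edges H. real (card R) \<le> \<delta> * real n ^ 3 \<and>
                three_partite (verts H, edges H - R))))))"
proof (intro conjI allI impI)
  note lim = ex2_ratio_F5_tendsto[OF assms]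
  show "convergent (ex2_ratio p F5)" using lim by (rule convergentI)
  show "pi2 p F5 = 2 / 3 powr (1 + p)" unfolding pi2_def using lim by (rule limI)
  fix \<delta> :: real assume \<delta>: "\<delta> > 0"
  \<comment> \<open>Half of \<delta> pays for the \<gamma> n^3 edges and the other half for the 6
    n^2 pruned ones; the cap 1/2 keeps 1 - \<gamma> positive.\<close>
  define \<gamma> where "\<gamma> = min (\<delta> / 2) (1 / 2)"
  define K where "K = 2 / 3 powr (1 + p)"
  define K' where "K' = ((1 - \<gamma>) / 3) powr p * (1 - (1 - \<gamma>) / 3)"
  \<comment> \<open>Chosen so that (1 - \<epsilon>) K is the midpoint of K' and K.\<close>
  define \<epsilon> where "\<epsilon> = (K - K') / (2 * K)"
  have \<gamma>: "0 < \<gamma>" "\<gamma> < 1" "\<gamma> \<le> \<delta> / 2" using \<delta> by (auto simp: \<gamma>_def)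
  have K: "0 < K" by (simp add: K_def)
  have KK': "K' < K" unfolding K_def K'_def using assms \<gamma> by (intro powr_mult_one_minus_less) auto
  have \<epsilon>: "0 < \<epsilon>" using K KK' by (simp add: \<epsilon>_def)
  have "(1 - \<epsilon>) * K = (K + K') / 2" using K by (simp add: \<epsilon>_def field_simps)
  then have "K' < (1 - \<epsilon>) * K - 6 * 0" using KK' by simp
  \<comment> \<open>The vanishing term 6 n^(-p) is the pruning error 6 n^2 divided by
    n^(2+p).\<close>
  moreover have "(\<lambda>n. (1 - \<epsilon>) * ex2_ratio p F5 n - 6 * real n powr (- p)) \<longlonglongrightarrow> (1 - \<epsilon>) * K - 6 * 0"
    using assms lim unfolding K_def
    by (intro tendsto_intros tendsto_neg_powr filterlim_real_sequentially) auto
  ultimately have "\<forall>\<^sub>F n in sequentially. K' < (1 - \<epsilon>) * ex2_ratio p F5 n - 6 * real n powr (- p)"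
    by (metis order_tendstoD(1))
  then obtain N1 where N1: "K' < (1 - \<epsilon>) * ex2_ratio p F5 n - 6 * real n powr (- p)" if "N1 \<le> n" for n
    unfolding eventually_sequentially by blast
  \<comment> \<open>From 12 / \<delta> on, 6 n^2 is at most half of \<delta> n^3.\<close>
  define N\<^sub>0 where "N\<^sub>0 = max (max N1 1) (nat \<lceil>12 / \<delta>\<rceil>)"
  show "\<exists>(\<epsilon>::real) (N\<^sub>0::nat). \<epsilon> > 0 \<and> N\<^sub>0 > 0 \<and>
        (\<forall>n::nat. n \<ge> N\<^sub>0 \<longrightarrow>
          (\<forall>H :: 'a hypergraph.
             three_graph H \<and> card (verts H) = n \<and> free_of F5 H \<and>
             norm2 p H \<ge> (1 - \<epsilon>) * ex2 p n F5 \<longrightarrow>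
             (\<exists>R \<subseteq> edges H. real (card R) \<le> \<delta> * real n ^ 3 \<and>
                three_partite (verts H, edges H - R))))"
  proof (intro exI[of _ \<epsilon>] exI[of _ N\<^sub>0] conjI allI impI)
    show "0 < \<epsilon>" by fact
    show "0 < N\<^sub>0" by (simp add: N\<^sub>0_def)
    fix n :: nat and H :: "'a hypergraph"
    assume n: "N\<^sub>0 \<le> n" and "three_graph H \<and> card (verts H) = n \<and> free_of F5 H \<and>
      norm2 p H \<ge> (1 - \<epsilon>) * ex2 p n F5"
    then have H: "three_graph H" "free_of F5 H" and card: "card (verts H) = n"
      and norm: "norm2 p H \<ge> (1 - \<epsilon>) * ex2 p n F5" by auto
    have n1: "1 \<le> n" "N1 \<le> n" "12 / \<delta> \<le> real n" using n by (auto simp: N\<^sub>0_def)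
    have "K' * real n powr (2 + p) <
        ((1 - \<epsilon>) * ex2_ratio p F5 n - 6 * real n powr (- p)) * real n powr (2 + p)"
      using N1[OF n1(2)] n1(1) by (intro mult_strict_right_mono) auto
    also have "\<dots> = (1 - \<epsilon>) * (ex2_ratio p F5 n * real n powr (2 + p)) -
        6 * (real n powr (- p) * real n powr (2 + p))"
      by (simp add: left_diff_distrib)
    also have "real n powr (- p) * real n powr (2 + p) = real n ^ 2"
      using n1(1) by (simp add: powr_add[symmetric])
    also have "ex2_ratio p F5 n * real n powr (2 + p) = 2 * ex2 p n F5"
      using n1(1) by (simp add: ex2_ratio_def)
    finally have "K' * real n powr (2 + p) + 6 * real n ^ 2 < 2 * norm2 p H" using norm by linarith
    then obtain R where R: "R \<subseteq> edges H" "three_partite (verts H, edges H - R)"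
      and cR: "real (card R) \<le> \<gamma> * real n ^ 3 + 6 * real n ^ 2"
      using F5_free_stability[OF H assms \<gamma>(1,2)] unfolding K'_def card by blast
    have "6 \<le> \<delta> / 2 * real n" using n1(3) \<delta> by (simp add: field_simps)
    then have "6 * real n ^ 2 \<le> \<delta> / 2 * real n * real n ^ 2" by (intro mult_right_mono) auto
    moreover have "\<gamma> * real n ^ 3 \<le> \<delta> / 2 * real n ^ 3" using \<gamma>(3) by (intro mult_right_mono) auto
    ultimately have "real (card R) \<le> \<delta> * real n ^ 3"
      using cR by (simp add: power2_eq_square power3_eq_cube)
    then show "\<exists>R \<subseteq> edges H. real (card R) \<le> \<delta> * real n ^ 3 \<and>
        three_partite (verts H, edges H - R)" using R by blast
  qed
qed

end
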